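(* Let $\alpha>-1$ and $\beta\in(0,1+\alpha]$. Then every harmonic mapping $f\in\mathcal{B}_{\mathcal{H}}^0(\alpha,\beta)$ is close-to-convex in $\mathbb{D}$.
   Context: $\mathbb{D}=\{z\in\mathbb{C}:|z|<1\}$. $\mathcal{H}^0$ is the class of harmonic mappings $f=h+\overline{g}$ in $\mathbb{D}$, where $h,g$ are analytic in $\mathbb{D}$ with $h(0)=g(0)=0$, $h'(0)=1$ and $g'(0)=0$. For $\alpha>-1$ and $\beta>0$, $\mathcal{B}_{\mathcal{H}}^0(\alpha,\beta)$ is the set of $f=h+\overline{g}\in\mathcal{H}^0$ such that $|zh''(z)+\alpha(h'(z)-1)|\le \beta-|zg''(z)+\alpha g'(z)|$ for all $z\in\mathbb{D}$. A harmonic mapping $f$ is called close-to-convex in $\mathbb{D}$ if $f(\mathbb{D})$ is a close-to-convex domain, i.e. the complement of $f(\mathbb{D})$ can be written as a disjoint union of non-intersecting half-lines. *)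

theory Defs
  imports "HOL-Complex_Analysis.Complex_Analysis"
begin

text \<open>
  Functions are total in HOL, so a harmonic mapping in the unit disc \<^term>\<open>ball (0::complex) 1\<close>
  is represented by any function on the plane, of which only the values on the disc matter.
  The normalisation at the origin determines \<open>h\<close> and \<open>g\<close> on the disc uniquely from \<open>f\<close>,
  so the existential quantifiers below involve no choice.
\<close>

definition canonical_decomposition ::
    "(complex \<Rightarrow> complex) \<Rightarrow> (complex \<Rightarrow> complex) \<Rightarrow> (complex \<Rightarrow> complex) \<Rightarrow> bool" where
  "canonical_decomposition f h g \<longleftrightarrow>
     h holomorphic_on ball 0 1 \<and> g holomorphic_on ball 0 1 \<and>
     h 0 = 0 \<and> g 0 = 0 \<and> deriv h 0 = 1 \<and> deriv g 0 = 0 \<and>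
     (\<forall>z\<in>ball 0 1. f z = h z + cnj (g z))"

definition class_H0 :: "(complex \<Rightarrow> complex) set" where
  "class_H0 = {f. \<exists>h g. canonical_decomposition f h g}"

definition class_B_H0 :: "real \<Rightarrow> real \<Rightarrow> (complex \<Rightarrow> complex) set" where
  "class_B_H0 \<alpha> \<beta> = {f \<in> class_H0. \<exists>h g. canonical_decomposition f h g \<and>
     (\<forall>z\<in>ball 0 1.
        cmod (z * deriv (deriv h) z + of_real \<alpha> * (deriv h z - 1))
          \<le> \<beta> - cmod (z * deriv (deriv g) z + of_real \<alpha> * deriv g z))}"

definition half_line :: "complex set \<Rightarrow> bool" where
  "half_line l \<longleftrightarrow> (\<exists>a d. d \<noteq> 0 \<and> l = {a + of_real t * d | t. t \<ge> 0})"

text \<open>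
  Half-lines are closed and pairwise disjoint in the strict sense: the end point of one of them
  may not lie on another. The empty family is allowed, so the whole plane is close-to-convex.
\<close>

definition close_to_convex_domain :: "complex set \<Rightarrow> bool" where
  "close_to_convex_domain \<Omega> \<longleftrightarrow>
     open \<Omega> \<and> connected \<Omega> \<and> \<Omega> \<noteq> {} \<and>
     (\<exists>L. (\<forall>l\<in>L. half_line l) \<and> pairwise disjnt L \<and> - \<Omega> = \<Union>L)"

definition close_to_convex :: "(complex \<Rightarrow> complex) \<Rightarrow> bool" where
  "close_to_convex f \<longleftrightarrow> close_to_convex_domain (f ` ball 0 1)"

end

theory Submission
  imports Defs
begin

text \<open>
  For unimodular \<open>\<epsilon>\<close>, the hypothesis bounds \<open>z p' + \<alpha> p\<close> by \<open>\<beta>\<close>, where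
  \<open>p = h' - 1 + \<epsilon> g'\<close>. By the Schwarz lemma and integration along radii,
  \<open>|p z| \<le> \<beta> |z| / (1 + \<alpha>) \<le> |z|\<close>. Hence \<open>u = f - id\<close> strictly decreases distances on the disc,
  and so does its continuous extension to the closed disc, which we call \<open>u\<close> too.

  Let \<open>P\<close> be the nearest-point projection onto the closed disc. Then \<open>F z = z + u (P z)\<close> is
  injective because \<open>u \<circ> P\<close> strictly decreases distances wherever it is not locally constant, and it is
  surjective by Brouwer's theorem because \<open>u\<close> is bounded. It agrees with \<open>f\<close> on the disc, and as \<open>P\<close>
  collapses each radial half-line \<open>{r \<zeta> | r \<ge> 1}\<close> to \<open>\<zeta>\<close>, it translates each of these half-lines.
  Their images are therefore disjoint half-lines that fill the complement of the image of the disc.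
\<close>

section \<open>Schwarz-type estimates and alignment of moduli\<close>

lemma Schwarz_bound:
  assumes holf: "f holomorphic_on ball 0 1" and f0: "f 0 = 0"
    and le: "\<And>z. cmod z < 1 \<Longrightarrow> cmod (f z) \<le> B" and z: "cmod z < 1"
  shows "cmod (f z) \<le> B * cmod z"
proof -
  have B: "0 \<le> B" using le[of 0] f0 by simp
  \<comment> \<open>The Schwarz lemma asks for modulus strictly below 1. Scaling by
    \<open>C > B\<close> provides this, also when \<open>B = 0\<close>, and then \<open>C\<close>
    decreases to \<open>B\<close>.\<close>
  have *: "cmod (f z) \<le> C * cmod z" if "C > B" for C
  proof -
    have C: "C > 0" using that B by simp
    have "cmod (f z / of_real C) \<le> cmod z"
    proof (rule Schwarz_Lemma(1)[where f = "\<lambda>z. f z / of_real C"])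
      show "(\<lambda>z. f z / of_real C) holomorphic_on ball 0 1"
        using C by (intro holomorphic_intros holf) auto
      show "cmod (f w / of_real C) < 1" if "cmod w < 1" for w
        using le[OF that] C \<open>C > B\<close> by (simp add: norm_divide)
    qed (use f0 z in auto)
    then show ?thesis using C by (simp add: norm_divide field_simps)
  qed
  show ?thesis
  proof (rule tendsto_lowerbound)
    show "((\<lambda>C. C * cmod z) \<longlongrightarrow> B * cmod z) (at_right B)"
      by (intro tendsto_intros)
    show "\<forall>\<^sub>F C in at_right B. cmod (f z) \<le> C * cmod z"
      using * by (auto simp: eventually_at_filter)
  qed simp
qed

text \<open>With \<open>p z = z * q z\<close> the operator equals z times (1 + \<alpha>) q + z q',
  so the Schwarz bound transfers \<beta> to the second factor. Up to a power of t, that factor is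
  the derivative of t^(1 + \<alpha>) q(t z) along a radius, and integrating t^\<alpha> over [0, 1]
  produces 1 / (1 + \<alpha>).\<close>

lemma Euler_operator_bound:
  fixes \<alpha> \<beta> :: real
  assumes holp: "p holomorphic_on ball 0 1" and p0: "p 0 = 0" and \<alpha>: "\<alpha> > -1"
    and le: "\<And>z. cmod z < 1 \<Longrightarrow> cmod (z * deriv p z + of_real \<alpha> * p z) \<le> \<beta>"
    and z: "cmod z < 1"
  shows "cmod (p z) \<le> \<beta> / (1 + \<alpha>) * cmod z"
proof -
  obtain q where holq: "q holomorphic_on ball 0 1"
    and q: "\<And>z. cmod z < 1 \<Longrightarrow> p z = z * q z"
    using Schwarz3[OF holp p0] by metis
  have dq: "(q has_field_derivative deriv q w) (at w)" if "cmod w < 1" for w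
    using holomorphic_derivI[OF holq open_ball] that by simp
  have dp: "deriv p w = q w + w * deriv q w" if "cmod w < 1" for w
  proof -
    have "((\<lambda>w. w * q w) has_field_derivative (q w + w * deriv q w)) (at w)"
      using dq[OF that] by (auto intro!: derivative_eq_intros)
    then have "(p has_field_derivative (q w + w * deriv q w)) (at w)"
      by (rule has_field_derivative_transform_within_open[where S = "ball 0 1"])
         (use that q in auto)
    then show ?thesis by (rule DERIV_imp_deriv)
  qed
  have key: "cmod (of_real (1 + \<alpha>) * q w + w * deriv q w) \<le> \<beta>" if w: "cmod w < 1" "w \<noteq> 0" for w
  proof -
    have "cmod (w * deriv p w + of_real \<alpha> * p w) \<le> \<beta> * cmod w"
      by (rule Schwarz_bound[where f = "\<lambda>w. w * deriv p w + of_real \<alpha> * p w"])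
         (use le p0 w in \<open>auto intro!: holomorphic_intros holp\<close>)
    moreover have "w * deriv p w + of_real \<alpha> * p w
        = w * (of_real (1 + \<alpha>) * q w + w * deriv q w)"
      using dp[OF w(1)] q[OF w(1)] by (simp add: algebra_simps)
    ultimately show ?thesis using w(2) by (simp add: norm_mult mult.commute)
  qed
  show ?thesis
  proof (cases "z = 0")
    case False
    \<comment> \<open>The power is the integrating factor. As 1 + \<alpha> > 0, \<open>G\<close> is
      continuous with \<open>G 0 = 0\<close> and \<open>G 1 = q z\<close>. For negative \<alpha> the
      bound on the derivative blows up at 0, so derivatives are taken on the open interval
      only.\<close>
    define G where "G t = (t powr (1 + \<alpha>)) *\<^sub>R q (of_real t * z)" for t :: real
    have tz: "cmod (of_real t * z) < 1" if "0 \<le> t" "t \<le> 1" for t :: real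
      using that z mult_left_le_one_le[of "cmod z" t] by (simp add: norm_mult)
    have "norm (G 1 - G 0) \<le> \<beta> / (1 + \<alpha>) * 1 powr (1 + \<alpha>) - \<beta> / (1 + \<alpha>) * 0 powr (1 + \<alpha>)"
    proof (rule differentiable_bound_general[where
        f' = "\<lambda>t. (t powr \<alpha>) *\<^sub>R (of_real (1 + \<alpha>) * q (of_real t * z)
               + of_real t * z * deriv q (of_real t * z))"
        and \<phi>' = "\<lambda>t. \<beta> * t powr \<alpha>"])
      show "continuous_on {0..1} G"
        unfolding G_def
        by (intro continuous_intros continuous_on_powr'
            continuous_on_compose2[OF holomorphic_on_imp_continuous_on[OF holq]])
           (use \<alpha> tz in auto)
      show "continuous_on {0..1} (\<lambda>t. \<beta> / (1 + \<alpha>) * t powr (1 + \<alpha>))"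
        by (intro continuous_intros continuous_on_powr') (use \<alpha> in auto)
    next
      fix t :: real assume t: "0 < t" "t < 1"
      have "((\<lambda>t. q (of_real t * z)) has_vector_derivative z * deriv q (of_real t * z)) (at t)"
      proof -
        have "((\<lambda>t. of_real t * z) has_vector_derivative z) (at t)"
          by (auto intro!: derivative_eq_intros)
        moreover have "(q has_field_derivative deriv q (of_real t * z)) (at (of_real t * z))"
          using dq tz t by simp
        ultimately show ?thesis using field_vector_diff_chain_at by (fastforce simp: o_def)
      qed
      moreover have "((\<lambda>t. t powr (1 + \<alpha>)) has_real_derivative (1 + \<alpha>) * t powr \<alpha>) (at t)"
        using t by (auto intro!: derivative_eq_intros)
      ultimately have "(G has_vector_derivative
          (t powr (1 + \<alpha>)) *\<^sub>R (z * deriv q (of_real t * z))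
          + ((1 + \<alpha>) * t powr \<alpha>) *\<^sub>R q (of_real t * z)) (at t)"
        unfolding G_def by (intro has_vector_derivative_scaleR)
      also have "(t powr (1 + \<alpha>)) *\<^sub>R (z * deriv q (of_real t * z))
          + ((1 + \<alpha>) * t powr \<alpha>) *\<^sub>R q (of_real t * z)
          = (t powr \<alpha>) *\<^sub>R (of_real (1 + \<alpha>) * q (of_real t * z)
               + of_real t * z * deriv q (of_real t * z))"
        using t by (simp add: powr_add scaleR_conv_of_real algebra_simps)
      finally show "(G has_vector_derivative \<dots>) (at t)" .
      show "((\<lambda>t. \<beta> / (1 + \<alpha>) * t powr (1 + \<alpha>)) has_vector_derivative \<beta> * t powr \<alpha>) (at t)"
        unfolding has_real_derivative_iff_has_vector_derivative[symmetric]
        using t \<alpha> by (auto intro!: derivative_eq_intros)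
      show "norm ((t powr \<alpha>) *\<^sub>R (of_real (1 + \<alpha>) * q (of_real t * z)
               + of_real t * z * deriv q (of_real t * z))) \<le> \<beta> * t powr \<alpha>"
        using key[of "of_real t * z"] tz[of t] t False
        by (simp add: mult_left_mono mult.commute[of \<beta>])
    qed simp
    then have "cmod (q z) \<le> \<beta> / (1 + \<alpha>)" using \<alpha> by (simp add: G_def)
    then have "cmod z * cmod (q z) \<le> cmod z * (\<beta> / (1 + \<alpha>))" by (rule mult_left_mono) simp
    then show ?thesis using q[OF z] by (simp add: norm_mult mult.commute)
  qed (simp add: p0)
qed

text \<open>Rotating \<open>b\<close> into the direction of \<open>a\<close> turns the triangle
  inequality into an equality. This lets one analytic function account for the moduli of both the
  analytic and the co-analytic part.\<close>

lemma unimodular_alignment: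
  obtains \<epsilon> :: complex where "cmod \<epsilon> = 1" "cmod (a + \<epsilon> * b) = cmod a + cmod b"
proof (cases "a = 0 \<or> b = 0")
  case True
  then show ?thesis using that[of 1] by auto
next
  case False
  define \<epsilon> where "\<epsilon> = sgn a * cnj (sgn b)"
  have "\<epsilon> * b = sgn a * of_real (cmod b)"
    using False by (simp add: \<epsilon>_def sgn_eq complex_norm_square[symmetric] power2_eq_square field_simps)
  moreover have "a = sgn a * of_real (cmod a)"
    using False by (simp add: sgn_eq)
  ultimately have "a + \<epsilon> * b = sgn a * of_real (cmod a + cmod b)"
    by (simp add: algebra_simps)
  then have "cmod (a + \<epsilon> * b) = cmod a + cmod b"
    using False by (simp only: norm_mult norm_sgn norm_of_real) simp
  then show ?thesis
    using that[of \<epsilon>] False by (simp add: \<epsilon>_def norm_mult norm_sgn)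
qed

section \<open>Shrinking perturbations of the identity\<close>

lemma shrinking_extension_cball:
  fixes u :: "complex \<Rightarrow> complex"
  assumes u: "\<And>z w. z \<in> ball 0 1 \<Longrightarrow> w \<in> ball 0 1 \<Longrightarrow> z \<noteq> w \<Longrightarrow> dist (u z) (u w) < dist z w"
  obtains v where "1-lipschitz_on (cball 0 1) v" "\<And>z. z \<in> ball 0 1 \<Longrightarrow> v z = u z"
    "\<And>z w. z \<in> cball 0 1 \<Longrightarrow> w \<in> cball 0 1 \<Longrightarrow> z \<noteq> w \<Longrightarrow> dist (v z) (v w) < dist z w"
proof -
  have "1-lipschitz_on (ball 0 1) u"
    by (rule lipschitz_onI) (metis u dist_self less_imp_le mult_1 order.refl, simp)
  from lipschitz_extend_closure[OF this] obtain v where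
    lip: "1-lipschitz_on (cball 0 1) v" and v: "\<And>z. z \<in> ball 0 1 \<Longrightarrow> v z = u z"
    by (auto simp: closure_ball)
  \<comment> \<open>Limits preserve only the 1-Lipschitz bound, but injectivity of the extended map
    will need strictness on the circle, where the nearest-point projection takes its values outside
    the disc.\<close>
  have "dist (v z) (v w) < dist z w" if zw: "z \<in> cball 0 1" "w \<in> cball 0 1" "z \<noteq> w" for z w
  proof -
    \<comment> \<open>By strict convexity, the middle piece of the segment lies in the open disc, where the inequality is strict.\<close>
    define a b where "a = midpoint z w" and "b = midpoint a w"
    have seg: "midpoint x y \<in> ball 0 1" if "x \<in> cball 0 1" "y \<in> cball 0 1" "x \<noteq> y" for x y :: complex
      using dist_decreases_open_segment[of "midpoint x y" x y 0] that by auto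
    have "a \<noteq> w" using zw by (simp add: a_def)
    then have "a \<noteq> b" unfolding b_def by (metis midpoint_eq_endpoint(1))
    have a: "a \<in> ball 0 1" using seg zw by (simp add: a_def)
    then have ab: "a \<in> ball 0 1" "b \<in> ball 0 1"
      using seg[of a w] zw \<open>a \<noteq> w\<close> by (simp_all add: b_def)
    have "dist (v z) (v w) \<le> dist (v z) (v a) + dist (v a) (v b) + dist (v b) (v w)"
      by (smt (verit) dist_triangle)
    also have "\<dots> < dist z a + dist a b + dist b w"
      using lipschitz_onD[OF lip, of z a] lipschitz_onD[OF lip, of b w] u[of a b] v[of a] v[of b]
        ab \<open>a \<noteq> b\<close> zw by simp
    also have "\<dots> = dist z w"
      by (simp add: a_def b_def dist_midpoint)
    finally show ?thesis .
  qed
  then show ?thesis using that lip v by blast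
qed

text \<open>A point of modulus 1 + t has distance at least t from every point of the closed disc,
  and \<zeta> attains this; convexity makes the nearest point unique.\<close>

lemma closest_point_cball_outside:
  fixes \<zeta> :: complex
  assumes \<zeta>: "cmod \<zeta> = 1" and t: "0 \<le> t"
  shows "closest_point (cball 0 1) (\<zeta> + of_real t * \<zeta>) = \<zeta>"
proof (rule closest_point_unique[symmetric])
  show "\<forall>w\<in>cball 0 1. dist (\<zeta> + of_real t * \<zeta>) \<zeta> \<le> dist (\<zeta> + of_real t * \<zeta>) w"
  proof
    fix w :: complex assume "w \<in> cball 0 1"
    then have w: "cmod w \<le> 1" by simp
    have "\<zeta> + of_real t * \<zeta> = of_real (1 + t) * \<zeta>" by (simp add: algebra_simps)
    then have "cmod (\<zeta> + of_real t * \<zeta>) = 1 + t"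
      using \<zeta> t by (simp only: norm_mult norm_of_real) simp
    then have "t \<le> cmod (\<zeta> + of_real t * \<zeta> - w)"
      using norm_triangle_ineq2[of "\<zeta> + of_real t * \<zeta>" w] w by simp
    then show "dist (\<zeta> + of_real t * \<zeta>) \<zeta> \<le> dist (\<zeta> + of_real t * \<zeta>) w"
      using \<zeta> t by (simp add: dist_norm norm_mult)
  qed
qed (use \<zeta> in auto)

lemma close_to_convex_shrinking_perturbation:
  assumes u: "\<And>z w. z \<in> ball 0 1 \<Longrightarrow> w \<in> ball 0 1 \<Longrightarrow> z \<noteq> w \<Longrightarrow> dist (u z) (u w) < dist z w"
    and f: "\<And>z. z \<in> ball 0 1 \<Longrightarrow> f z = z + u z"
  shows "close_to_convex f"
proof -
  obtain v where lip: "1-lipschitz_on (cball 0 1) v" and vu: "\<And>z. z \<in> ball 0 1 \<Longrightarrow> v z = u z"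
    and v: "\<And>z w. z \<in> cball 0 1 \<Longrightarrow> w \<in> cball 0 1 \<Longrightarrow> z \<noteq> w \<Longrightarrow> dist (v z) (v w) < dist z w"
    by (rule shrinking_extension_cball[where u = u]) (use u in auto)
  define P :: "complex \<Rightarrow> complex" where "P = closest_point (cball 0 1)"
  define F where "F z = z + v (P z)" for z
  have P: "P z \<in> cball 0 1" for z
    unfolding P_def by (intro closest_point_in_set) auto
  have Plip: "dist (P z) (P w) \<le> dist z w" for z w
    unfolding P_def by (intro closest_point_lipschitz) auto
  have contvP: "continuous_on S (\<lambda>z. v (P z))" for S
    by (rule continuous_on_compose2[OF lipschitz_on_continuous_on[OF lip]])
       (use P in \<open>auto simp: P_def intro!: continuous_on_closest_point\<close>)
  have contF: "continuous_on S F" for S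
    unfolding F_def by (intro continuous_intros contvP)
  have inj: "z = w" if "F z = F w" for z w
  proof (rule ccontr)
    assume "z \<noteq> w"
    have "z - w = v (P w) - v (P z)"
      using that by (simp add: F_def diff_eq_eq eq_diff_eq algebra_simps)
    then have eq: "dist z w = dist (v (P w)) (v (P z))"
      by (simp add: dist_norm)
    \<comment> \<open>Equal projections would give \<open>dist z w = 0\<close>. For distinct ones,
      \<open>v\<close> strictly shrinks their distance, which is at most \<open>dist z w\<close>,
      contradicting \<open>eq\<close>.\<close>
    then have "P z \<noteq> P w" using \<open>z \<noteq> w\<close> by auto
    then show False using v[OF P P, of z w] Plip[of z w] eq by (simp add: dist_commute)
  qed
  have surj: "\<exists>z. F z = w" for w
  proof -
    have "bounded (v ` cball 0 1)"
      by (intro compact_imp_bounded compact_continuous_image lipschitz_on_continuous_on[OF lip])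
         simp
    then obtain R where R: "R > 0" "\<And>z. z \<in> cball 0 1 \<Longrightarrow> norm (v z) \<le> R"
      by (auto simp: bounded_pos)
    \<comment> \<open>Preimages of \<open>w\<close> under \<open>F\<close> are the fixed points of
      this map, which sends \<open>cball w R\<close> into itself because \<open>R\<close> bounds
      \<open>v\<close>.\<close>
    have "continuous_on (cball w R) (\<lambda>z. w - v (P z))"
      by (intro continuous_intros contvP)
    then obtain z where "w - v (P z) = z"
      by (rule brouwer_ball[OF R(1)]) (use R P in \<open>auto simp: dist_norm\<close>)
    then have "F z = w" by (simp add: F_def diff_eq_eq)
    then show ?thesis ..
  qed
  have Ff: "F z = f z" if "z \<in> ball 0 1" for z
    using that by (simp add: F_def P_def closest_point_self f vu)
  define ray :: "complex \<Rightarrow> complex set" where "ray \<zeta> = {\<zeta> + of_real t * \<zeta> | t. t \<ge> 0}" for \<zeta>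
  have F_ray: "F ` ray \<zeta> = {\<zeta> + v \<zeta> + of_real t * \<zeta> | t. t \<ge> 0}" if "cmod \<zeta> = 1" for \<zeta>
  proof -
    have "F (\<zeta> + of_real t * \<zeta>) = \<zeta> + v \<zeta> + of_real t * \<zeta>" if "t \<ge> 0" for t
      using closest_point_cball_outside[OF \<open>cmod \<zeta> = 1\<close> that] by (simp add: F_def P_def)
    then show ?thesis unfolding ray_def by force
  qed
  \<comment> \<open>Polar coordinates: a point of a ray determines its direction, so distinct rays
    are disjoint.\<close>
  have rayD: "z = of_real (cmod z) * \<zeta> \<and> cmod z \<ge> 1" if "z \<in> ray \<zeta>" "cmod \<zeta> = 1" for z \<zeta>
  proof -
    obtain t where t: "t \<ge> 0" "z = of_real (1 + t) * \<zeta>"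
      using \<open>z \<in> ray \<zeta>\<close> by (auto simp: ray_def algebra_simps)
    then have "cmod z = 1 + t" using \<open>cmod \<zeta> = 1\<close> by (simp only: norm_mult norm_of_real) simp
    then show ?thesis using t by simp
  qed
  have rays: "- ball 0 1 = \<Union>(ray ` sphere 0 1)"
  proof (intro equalityI subsetI)
    fix z :: complex assume "z \<in> - ball 0 1"
    then have z: "cmod z \<ge> 1" by simp
    then have "z \<noteq> 0" by auto
    then have "z = sgn z + of_real (cmod z - 1) * sgn z"
      by (simp add: sgn_eq field_simps)
    then have "z \<in> ray (sgn z)" using z by (auto simp: ray_def intro!: exI[of _ "cmod z - 1"])
    moreover have "sgn z \<in> sphere 0 1" using \<open>z \<noteq> 0\<close> by (simp add: norm_sgn)
    ultimately show "z \<in> \<Union>(ray ` sphere 0 1)" by blast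
  qed (use rayD in force)
  have image: "f ` ball 0 1 = F ` ball 0 1" using Ff by simp
  \<comment> \<open>Injectivity and continuity suffice here, by invariance of domain.\<close>
  have "open (F ` ball 0 1)"
    by (intro invariance_of_domain contF) (auto intro!: inj_onI inj)
  moreover have "connected (F ` ball 0 1)"
    by (intro connected_continuous_image contF) auto
  moreover have "- F ` ball 0 1 = \<Union>((\<lambda>\<zeta>. F ` ray \<zeta>) ` sphere 0 1)"
  proof -
    have "bij F" using inj surj by (metis bijI injI surjI surj_def)
    then have "- F ` ball 0 1 = F ` (- ball 0 1)" by (simp add: bij_image_Compl_eq)
    then show ?thesis by (simp add: rays image_UN)
  qed
  moreover have "half_line (F ` ray \<zeta>)" if "\<zeta> \<in> sphere 0 1" for \<zeta>
    using F_ray[of \<zeta>] that unfolding half_line_def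
    by (intro exI[of _ "\<zeta> + v \<zeta>"] exI[of _ \<zeta>]) auto
  moreover have "pairwise disjnt ((\<lambda>\<zeta>. F ` ray \<zeta>) ` sphere 0 1)"
  proof -
    have "F ` ray \<zeta> \<inter> F ` ray \<xi> = {}" if "\<zeta> \<in> sphere 0 1" "\<xi> \<in> sphere 0 1" "\<zeta> \<noteq> \<xi>" for \<zeta> \<xi>
    proof -
      have False if "z \<in> ray \<zeta>" "z \<in> ray \<xi>" for z
        using rayD[of z \<zeta>] rayD[of z \<xi>] that \<open>\<zeta> \<in> _\<close> \<open>\<xi> \<in> _\<close> \<open>\<zeta> \<noteq> \<xi>\<close>
        by (metis mult_cancel_left norm_of_real of_real_0 of_real_eq_iff not_one_le_zero mem_sphere_0)
      then show ?thesis using inj by blast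
    qed
    then show ?thesis unfolding pairwise_def disjnt_def by blast
  qed
  ultimately show ?thesis
    unfolding close_to_convex_def close_to_convex_domain_def image
    by (intro conjI exI[of _ "(\<lambda>\<zeta>. F ` ray \<zeta>) ` sphere 0 1"]) auto
qed

section \<open>From the differential inequality to a shrinking perturbation\<close>

theorem theorem2p2:
  fixes \<alpha> \<beta> :: real and f :: "complex \<Rightarrow> complex"
  assumes "\<alpha> > -1" and "\<beta> \<in> {0<..1 + \<alpha>}" and "f \<in> class_B_H0 \<alpha> \<beta>"
  shows "close_to_convex f"
proof -
  obtain h g where holh: "h holomorphic_on ball 0 1" and holg: "g holomorphic_on ball 0 1"
    and h1: "deriv h 0 = 1" and g1: "deriv g 0 = 0"
    and f: "\<And>z. z \<in> ball 0 1 \<Longrightarrow> f z = h z + cnj (g z)"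
    and B: "\<And>z. z \<in> ball 0 1 \<Longrightarrow> cmod (z * deriv (deriv h) z + of_real \<alpha> * (deriv h z - 1))
          \<le> \<beta> - cmod (z * deriv (deriv g) z + of_real \<alpha> * deriv g z)"
    using assms(3) unfolding class_B_H0_def canonical_decomposition_def by blast
  \<comment> \<open>The triangle inequality merges the two moduli of the hypothesis into one bound
    for every unimodular \<epsilon>; \<beta> \<le> 1 + \<alpha> then makes the constant at most
    1.\<close>
  have bound: "cmod (deriv h z - 1 + \<epsilon> * deriv g z) \<le> cmod z"
    if z: "cmod z < 1" and \<epsilon>: "cmod \<epsilon> = 1" for z \<epsilon>
  proof -
    define p where "p z = deriv h z - 1 + \<epsilon> * deriv g z" for z
    have holp: "p holomorphic_on ball 0 1"
      unfolding p_def by (intro holomorphic_intros holh holg) auto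
    have "cmod (p z) \<le> \<beta> / (1 + \<alpha>) * cmod z"
    proof (rule Euler_operator_bound[OF holp _ assms(1) _ z])
      fix w :: complex assume w: "cmod w < 1"
      have "(deriv h has_field_derivative deriv (deriv h) w) (at w)"
        "(deriv g has_field_derivative deriv (deriv g) w) (at w)"
        using w by (auto intro!: holomorphic_derivI[where S = "ball 0 1"] holomorphic_deriv holh holg)
      then have "(p has_field_derivative deriv (deriv h) w + \<epsilon> * deriv (deriv g) w) (at w)"
        unfolding p_def by (auto intro!: derivative_eq_intros)
      then have "deriv p w = deriv (deriv h) w + \<epsilon> * deriv (deriv g) w"
        by (rule DERIV_imp_deriv)
      then have "w * deriv p w + of_real \<alpha> * p w
          = (w * deriv (deriv h) w + of_real \<alpha> * (deriv h w - 1))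
            + \<epsilon> * (w * deriv (deriv g) w + of_real \<alpha> * deriv g w)"
        by (simp add: p_def algebra_simps)
      then have "cmod (w * deriv p w + of_real \<alpha> * p w)
          \<le> cmod (w * deriv (deriv h) w + of_real \<alpha> * (deriv h w - 1))
            + cmod (w * deriv (deriv g) w + of_real \<alpha> * deriv g w)"
        using norm_triangle_ineq \<epsilon> by (metis mult_1 norm_mult)
      then show "cmod (w * deriv p w + of_real \<alpha> * p w) \<le> \<beta>"
        using B[of w] w by simp
    qed (simp add: p_def h1 g1)
    also have "\<dots> \<le> 1 * cmod z"
      by (rule mult_right_mono) (use assms in \<open>auto simp: field_simps\<close>)
    finally show ?thesis by (simp add: p_def)
  qed
  define u where "u z = h z - z + cnj (g z)" for z
  have "dist (u z) (u w) < dist z w" if zw: "z \<in> ball 0 1" "w \<in> ball 0 1" "z \<noteq> w" for z w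
  proof -
    \<comment> \<open>As \<open>u\<close> is only harmonic, its increment is compared with that of
      the analytic function h - id + \<epsilon> g, where \<epsilon> is chosen for this pair of
      points.\<close>
    obtain \<epsilon> where \<epsilon>: "cmod \<epsilon> = 1"
      and al: "cmod ((h z - z - (h w - w)) + \<epsilon> * (g z - g w)) = cmod (h z - z - (h w - w)) + cmod (g z - g w)"
      by (rule unimodular_alignment)
    \<comment> \<open>On the convex set \<open>cball 0 r\<close>, which contains both points,
      \<open>bound\<close> keeps the derivative at most r < 1; this is the source of
      strictness.\<close>
    define r where "r = max (cmod z) (cmod w)"
    have r: "r < 1" using zw by (simp add: r_def)
    have "u z - u w = (h z - z - (h w - w)) + cnj (g z - g w)"
      by (simp add: u_def algebra_simps)
    then have "dist (u z) (u w) \<le> cmod (h z - z - (h w - w)) + cmod (g z - g w)"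
      unfolding dist_norm by (metis complex_mod_cnj norm_triangle_ineq)
    also have "\<dots> = cmod ((h z - z + \<epsilon> * g z) - (h w - w + \<epsilon> * g w))"
      unfolding al[symmetric] by (simp add: algebra_simps)
    also have "\<dots> \<le> r * cmod (z - w)"
    proof (rule field_differentiable_bound)
      fix x :: complex assume x: "x \<in> cball 0 r"
      then have "cmod x < 1" using r by simp
      then have "(h has_field_derivative deriv h x) (at x)" "(g has_field_derivative deriv g x) (at x)"
        by (auto intro!: holomorphic_derivI[where S = "ball 0 1"] holh holg)
      then have "((\<lambda>z. h z - z + \<epsilon> * g z) has_field_derivative deriv h x - 1 + \<epsilon> * deriv g x) (at x)"
        by (auto intro!: derivative_eq_intros)
      then show "((\<lambda>z. h z - z + \<epsilon> * g z) has_field_derivative deriv h x - 1 + \<epsilon> * deriv g x)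
          (at x within cball 0 r)"
        by (rule has_field_derivative_at_within)
      show "cmod (deriv h x - 1 + \<epsilon> * deriv g x) \<le> r"
        using bound[OF \<open>cmod x < 1\<close> \<epsilon>] x by simp
    qed (auto simp: r_def)
    also have "\<dots> < dist z w" using r zw by (simp add: dist_norm)
    finally show ?thesis .
  qed
  then show ?thesis
    by (rule close_to_convex_shrinking_perturbation) (auto simp: f u_def)
qed

end
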